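(* Let $p$ be a prime, $G$ a finite $p$-group, and $e:=\log_p(\exp(G/G'))$. (1) Assume $\mathrm{Aut}(G)\subseteq\zeta\mathrm{End}(G)$. Then for every endomorphism $\varphi$ of $G$, $\mathrm{im}(\varphi)$ is a characteristic subgroup of $G$. In particular, all cyclic subgroups of $G$ whose order divides $p^e$ are characteristic in $G$, and $\Omega_1(G)\leq\zeta G$. (2) Assume $\mathrm{End}(G)$ is commutative. Then for every endomorphism $\varphi$ of $G$, $\mathrm{im}(\varphi)$ is a fully-invariant subgroup of $G$. In particular, all cyclic subgroups of $G$ whose order divides $p^e$ are fully-invariant in $G$. (3) If $\mathrm{Aut}(G)\subseteq\zeta\mathrm{End}(G)$, then $G$ cannot be written as a semidirect product in a nontrivial way (that is, there are no nontrivial subgroups $N,H\leq G$ with $G=N\rtimes H$). In particular, every endomorphism $\varphi$ of $G$ is either an automorphism or nilpotent, meaning that $\varphi^n$ is the trivial endomorphism of $G$ for some positive integer $n$.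
   Context: $\mathrm{End}(G)$ is the monoid of endomorphisms of $G$ under composition, and $\zeta\mathrm{End}(G)$ is its center, i.e. the set of endomorphisms commuting with all endomorphisms of $G$. $\zeta G$ is the center of $G$, $G'$ its commutator subgroup, $\exp$ denotes the exponent of a group, and $\Omega_1(G)$ is the subgroup of $G$ generated by all elements of order $p$. A subgroup is fully-invariant if every endomorphism of $G$ maps it into itself. $G=N\rtimes H$ means that $N$ is normal in $G$, $NH=G$ and $N\cap H=1$. *)

theory Defs
  imports Complex_Main "HOL-Algebra.Elementary_Groups" "HOL-Algebra.Bij"
    "HOL-Algebra.Multiplicative_Group" "HOL-Computational_Algebra.Primes"
begin

definition finite_p_group :: "nat \<Rightarrow> ('a, 'b) monoid_scheme \<Rightarrow> bool" where
  "finite_p_group p G \<longleftrightarrow> group G \<and> finite (carrier G) \<and> (\<exists>n::nat. order G = p ^ n)"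

text \<open>
  As for \<^const>\<open>auto\<close>, endomorphisms are represented by extensional functions, so
  that each endomorphism has exactly one representative and equality in the monoid is
  equality of maps on the carrier.
\<close>

definition End_monoid :: "('a, 'b) monoid_scheme \<Rightarrow> ('a \<Rightarrow> 'a) monoid" where
  "End_monoid G =
    \<lparr>carrier = hom G G \<inter> extensional (carrier G),
     monoid.mult = compose (carrier G),
     one = (\<lambda>x\<in>carrier G. x)\<rparr>"

definition trivial_endo :: "('a, 'b) monoid_scheme \<Rightarrow> 'a \<Rightarrow> 'a" where
  "trivial_endo G = (\<lambda>x\<in>carrier G. \<one>\<^bsub>G\<^esub>)"

text \<open>Used both for groups and for the endomorphism monoid.\<close>

definition center :: "('a, 'b) monoid_scheme \<Rightarrow> 'a set" where
  "center M = {z \<in> carrier M. \<forall>x\<in>carrier M. z \<otimes>\<^bsub>M\<^esub> x = x \<otimes>\<^bsub>M\<^esub> z}"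

definition group_exponent :: "('a, 'b) monoid_scheme \<Rightarrow> nat" where
  "group_exponent G = (LEAST n. 0 < n \<and> (\<forall>x\<in>carrier G. x [^]\<^bsub>G\<^esub> n = \<one>\<^bsub>G\<^esub>))"

definition Omega1 :: "nat \<Rightarrow> ('a, 'b) monoid_scheme \<Rightarrow> 'a set" where
  "Omega1 p G = generate G {x \<in> carrier G. group.ord G x = p}"

definition characteristic :: "'a set \<Rightarrow> ('a, 'b) monoid_scheme \<Rightarrow> bool" where
  "characteristic H G \<longleftrightarrow> subgroup H G \<and> (\<forall>\<alpha>\<in>auto G. \<alpha> ` H = H)"

definition fully_invariant :: "'a set \<Rightarrow> ('a, 'b) monoid_scheme \<Rightarrow> bool" where
  "fully_invariant H G \<longleftrightarrow> subgroup H G \<and> (\<forall>\<phi>\<in>carrier (End_monoid G). \<phi> ` H \<subseteq> H)"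

definition cyclic_subgroup :: "'a set \<Rightarrow> ('a, 'b) monoid_scheme \<Rightarrow> bool" where
  "cyclic_subgroup C G \<longleftrightarrow> subgroup C G \<and> cyclic_group (G\<lparr>carrier := C\<rparr>)"

definition semidirect_decomp :: "('a, 'b) monoid_scheme \<Rightarrow> 'a set \<Rightarrow> 'a set \<Rightarrow> bool" where
  "semidirect_decomp G N H \<longleftrightarrow>
     N \<lhd> G \<and> subgroup H G \<and> N <#>\<^bsub>G\<^esub> H = carrier G \<and> N \<inter> H = {\<one>\<^bsub>G\<^esub>}"

lemma (in group) group_exponent_dvd:
  assumes n: "0 < n" "\<forall>x\<in>carrier G. x [^] n = \<one>"
  shows "group_exponent G dvd n"
proof -
  let ?P = "\<lambda>n::nat. 0 < n \<and> (\<forall>x\<in>carrier G. x [^] n = \<one>)"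
  define m where "m = group_exponent G"
  have m: "?P m" unfolding m_def group_exponent_def by (rule LeastI[of ?P n]) (use n in blast)
  have min: "m \<le> k" if "?P k" for k
    unfolding m_def group_exponent_def by (rule Least_le) (rule that)
  have "x [^] (n mod m) = \<one>" if x: "x \<in> carrier G" for x
  proof -
    have "\<one> = x [^] (m * (n div m) + n mod m)" using n x by simp
    also have "\<dots> = x [^] (m * (n div m)) \<otimes> x [^] (n mod m)"
      using x by (simp only: nat_pow_mult)
    also have "x [^] (m * (n div m)) = (x [^] m) [^] (n div m)"
      using x by (simp only: nat_pow_pow)
    also have "\<dots> = \<one>" using m x by simp
    finally show ?thesis using x by simp
  qed
  then have "\<not> 0 < n mod m" using min[of "n mod m"] m by (meson mod_less_divisor not_le)
  then show ?thesis unfolding m_def by (simp add: mod_eq_0_iff_dvd)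
qed

text \<open>The exponent of $G/G'$ is a power of $p$, so that its logarithm is a natural number.\<close>

lemma log_exponent_abelianization_ex1:
  assumes "prime (p::nat)" and "finite_p_group p G"
  shows "\<exists>!e::nat. real e = log (real p) (real (group_exponent (G Mod derived G (carrier G))))"
proof -
  interpret group G using assms by (simp add: finite_p_group_def)
  let ?D = "derived G (carrier G)"
  interpret D: normal ?D G by (rule derived_self_is_normal)
  interpret Q: group "G Mod ?D" by (rule D.factorgroup_is_group)
  obtain n where n: "order G = p ^ n" using assms by (auto simp: finite_p_group_def)
  have p: "1 < p" using assms(1) by (rule prime_gt_1_nat)
  have "X [^]\<^bsub>G Mod ?D\<^esub> (p ^ n) = \<one>\<^bsub>G Mod ?D\<^esub>" if X: "X \<in> carrier (G Mod ?D)" for X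
  proof -
    obtain x where x: "x \<in> carrier G" "X = ?D #>\<^bsub>G\<^esub> x"
      using X by (auto simp: carrier_FactGroup)
    have "?D #>\<^bsub>G\<^esub> x [^]\<^bsub>G\<^esub> (p ^ n) = X [^]\<^bsub>G Mod ?D\<^esub> (p ^ n)"
      using D.FactGroup_pow x by metis
    moreover have "x [^]\<^bsub>G\<^esub> (p ^ n) = \<one>\<^bsub>G\<^esub>" using pow_order_eq_1 x n by metis
    ultimately show ?thesis
      using D.subset by (simp add: FactGroup_def coset_mult_one)
  qed
  then have "group_exponent (G Mod ?D) dvd p ^ n"
    using p by (intro Q.group_exponent_dvd) auto
  then obtain k where "group_exponent (G Mod ?D) = p ^ k"
    using divides_primepow_nat[OF assms(1)] by blast
  then have "log (real p) (real (group_exponent (G Mod ?D))) = real k"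
    using p by (simp add: log_nat_power)
  then show ?thesis by auto
qed

end

theory Submission
  imports Defs "HOL-Number_Theory.Cong" "HOL-Algebra.Zassenhaus"
begin

text \<open>
  Call \<open>f\<close> additive modulo \<open>n\<close> on a subgroup if it is a homomorphism to the integers modulo
  \<open>n\<close>. If \<open>K\<close> contains $G'$, every $x^n$ lies in \<open>K\<close>, and \<open>a\<close> has order exactly \<open>n\<close> modulo
  \<open>K\<close>, then extending over larger and larger subgroups gives such an \<open>f\<close> on all of \<open>G\<close> that
  vanishes on \<open>K\<close> with \<open>f(a) = 1\<close>. Hence for every \<open>x\<close> with $x^n = 1$ the map
  $g \mapsto x^{f(g)}$ is an endomorphism sending \<open>a\<close> to \<open>x\<close>. With $K = G'$ and $n = p^e$ every
  cyclic subgroup of order dividing $p^e$ is the image of an endomorphism; such images are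
  invariant under whatever commutes with the endomorphism.

  Assume that automorphisms are central in the endomorphism monoid. Inner automorphisms commute,
  so $G'$ is central; and since inner automorphisms commute with $g \mapsto x^{f(g)}$, whose image
  is abelian, every \<open>x\<close> of order \<open>p\<close> is central.
  Let $\pi$ be an idempotent endomorphism with image \<open>H\<close>, neither trivial nor the identity. As
  $G'$ is central, $K = G'H$ is proper, so for \<open>x \<in> H\<close> of order \<open>p\<close> there is an endomorphism
  $\varphi$ that vanishes on \<open>K\<close>, takes values in the powers of \<open>x\<close>, and has
  $\varphi(a) = x$. Then $\alpha(g) = g\varphi(g)$ is an automorphism, and comparing $\alpha\pi$
  with $\pi\alpha$ at \<open>a\<close> gives \<open>x = 1\<close>, a contradiction. Semidirect decompositions give idempotent
  endomorphisms, and every endomorphism has an idempotent power.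
\<close>

section \<open>Functions additive modulo n and their extension\<close>

text \<open>Integer values taken up to congruence serve directly as exponents, and an extension may
  pick representatives freely because only residues matter.\<close>

definition additive_mod :: "nat \<Rightarrow> ('a, 'b) monoid_scheme \<Rightarrow> 'a set \<Rightarrow> ('a \<Rightarrow> int) \<Rightarrow> bool" where
  "additive_mod n G B f \<longleftrightarrow> (\<forall>x\<in>B. \<forall>y\<in>B. [f (x \<otimes>\<^bsub>G\<^esub> y) = f x + f y] (mod int n))"

context group
begin

lemma inv_mult_cancel:
  assumes "x \<in> carrier G" "y \<in> carrier G"
  shows "inv x \<otimes> (x \<otimes> y) = y" and "x \<otimes> (inv x \<otimes> y) = y"
  using assms by (simp_all flip: m_assoc)

lemma commutator_in_derived:
  assumes "x \<in> carrier G" "y \<in> carrier G"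
  shows "x \<otimes> y \<otimes> inv x \<otimes> inv y \<in> derived G (carrier G)"
  unfolding derived_def using assms by (intro generate.incl) blast

lemma additive_mod_one:
  assumes "subgroup B G" "additive_mod n G B f"
  shows "[f \<one> = 0] (mod int n)"
proof -
  have "[f (\<one> \<otimes> \<one>) = f \<one> + f \<one>] (mod int n)"
    using assms subgroup.one_closed unfolding additive_mod_def by blast
  then show ?thesis by (simp add: cong_iff_dvd_diff)
qed

lemma additive_mod_nat_pow:
  fixes k :: nat
  assumes "subgroup B G" "additive_mod n G B f" "x \<in> B"
  shows "[f (x [^] k) = int k * f x] (mod int n)"
proof (induction k)
  case 0
  then show ?case using additive_mod_one[OF assms(1,2)] by simp
next
  case (Suc k)
  have "x [^] k \<in> B" using assms by (metis subgroup_int_pow_closed int_pow_int)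
  then have "[f (x [^] Suc k) = f (x [^] k) + f x] (mod int n)"
    using assms unfolding additive_mod_def by simp
  also have "[f (x [^] k) + f x = int k * f x + f x] (mod int n)"
    using Suc by (intro cong_add) auto
  finally show ?case by (simp add: algebra_simps)
qed

text \<open>Since \<open>B\<close> contains G', it is normal, and conjugation changes an element of
  \<open>B\<close> only by a factor in G', where \<open>f\<close> vanishes modulo n. Hence
  \<open>f\<close> is conjugation invariant modulo n, and sending b x^i to f(b) + i t is additive on
  B<x>. The condition on \<open>t\<close> makes this consistent wherever powers of \<open>x\<close>
  already lie in \<open>B\<close>.\<close>

lemma additive_mod_extend:
  assumes B: "subgroup B G" and f: "additive_mod n G B f"
    and D: "derived G (carrier G) \<subseteq> B"
    and fD: "\<And>d. d \<in> derived G (carrier G) \<Longrightarrow> [f d = 0] (mod int n)"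
    and x: "x \<in> carrier G"
    and t: "\<And>i::int. x [^] i \<in> B \<Longrightarrow> [f (x [^] i) = i * t] (mod int n)"
  obtains C h where "subgroup C G" "B \<subseteq> C" "x \<in> C" "additive_mod n G C h"
    "\<And>b. b \<in> B \<Longrightarrow> [h b = f b] (mod int n)" "[h x = t] (mod int n)"
proof -
  interpret B: subgroup B G by (rule B)
  have Bc: "b \<in> carrier G" if "b \<in> B" for b using that B.subset by blast
  have fadd: "[f (b \<otimes> c) = f b + f c] (mod int n)" if "b \<in> B" "c \<in> B" for b c
    using f that unfolding additive_mod_def by blast
  define conj where "conj g b = g \<otimes> b \<otimes> inv g" for g b
  \<comment> \<open>A conjugate of \<open>b\<close> is \<open>b\<close> times a commutator, so both
    closure of \<open>B\<close> and invariance of \<open>f\<close> follow from the behaviour of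
    \<open>f\<close> on G'.\<close>
  have conj_eq: "conj g b = (g \<otimes> b \<otimes> inv g \<otimes> inv b) \<otimes> b" if "g \<in> carrier G" "b \<in> B" for g b
    using that Bc by (simp add: conj_def m_assoc)
  have conj: "conj g b \<in> B" "[f (conj g b) = f b] (mod int n)" if "g \<in> carrier G" "b \<in> B" for g b
  proof -
    have d: "g \<otimes> b \<otimes> inv g \<otimes> inv b \<in> derived G (carrier G)" (is "?d \<in> _")
      using that Bc by (intro commutator_in_derived) auto
    then show "conj g b \<in> B" using D that conj_eq by auto
    have "[f (?d \<otimes> b) = f ?d + f b] (mod int n)" using d D that by (intro fadd) auto
    also have "[f ?d + f b = 0 + f b] (mod int n)" using fD[OF d] by (intro cong_add) auto
    finally show "[f (conj g b) = f b] (mod int n)" using conj_eq[OF that] by simp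
  qed
  define C where "C = {b \<otimes> x [^] i |b i::int. b \<in> B}"
  have CI: "b \<otimes> x [^] i \<in> C" if "b \<in> B" for b and i :: int using that unfolding C_def by blast
  have CE: "\<exists>b\<in>B. \<exists>i::int. g = b \<otimes> x [^] i" if "g \<in> C" for g
    using that unfolding C_def mem_Collect_eq by metis
  have mult: "(b \<otimes> x [^] i) \<otimes> (c \<otimes> x [^] j) = (b \<otimes> conj (x [^] i) c) \<otimes> x [^] (i + j)"
    if "b \<in> B" "c \<in> B" for b c and i j :: int
    using that Bc x by (simp add: conj_def m_assoc int_pow_mult inv_mult_cancel)
  have inv: "inv (b \<otimes> x [^] i) = conj (x [^] (- i)) (inv b) \<otimes> x [^] (- i)"
    if "b \<in> B" for b and i :: int
    using that Bc x by (simp add: conj_def m_assoc inv_mult_group int_pow_neg inv_mult_cancel)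
  \<comment> \<open>Two decompositions of the same element differ by a power of \<open>x\<close>
    lying in \<open>B\<close>, where \<open>t\<close> prescribes the value of
    \<open>f\<close>.\<close>
  have well_defined: "[f b + i * t = f c + j * t] (mod int n)"
    if eq: "b \<otimes> x [^] i = c \<otimes> x [^] j" and bc: "b \<in> B" "c \<in> B" for b c i j
  proof -
    have "inv c \<otimes> b \<otimes> x [^] i = x [^] j"
      using eq bc Bc x by (simp add: m_assoc inv_mult_cancel)
    then have q: "inv c \<otimes> b = x [^] (j - i)"
      using bc Bc x by (simp add: int_pow_diff inv_solve_right)
    have qB: "inv c \<otimes> b \<in> B" using bc by simp
    have "[f (c \<otimes> (inv c \<otimes> b)) = f c + f (inv c \<otimes> b)] (mod int n)"
      using bc(2) qB by (rule fadd)
    also have "c \<otimes> (inv c \<otimes> b) = b" using bc Bc by (simp add: inv_mult_cancel)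
    finally have "[f b = f c + f (inv c \<otimes> b)] (mod int n)" .
    also have "[f c + f (inv c \<otimes> b) = f c + (j - i) * t] (mod int n)"
      using t[of "j - i"] q qB by (intro cong_add) auto
    finally have "[f b + i * t = (f c + (j - i) * t) + i * t] (mod int n)"
      by (intro cong_add) auto
    then show ?thesis by (simp add: algebra_simps)
  qed
  \<comment> \<open>\<open>r\<close> selects some decomposition b x^i; by
    \<open>well_defined\<close>, the choice affects \<open>h\<close> only by multiples of n.\<close>
  define r where "r g = (SOME (b, i::int). b \<in> B \<and> g = b \<otimes> x [^] i)" for g
  define h where "h g = f (fst (r g)) + snd (r g) * t" for g
  have h: "[h (b \<otimes> x [^] i) = f b + i * t] (mod int n)" if "b \<in> B" for b i
  proof -
    have "case r (b \<otimes> x [^] i) of (c, j) \<Rightarrow> c \<in> B \<and> b \<otimes> x [^] i = c \<otimes> x [^] j"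
      unfolding r_def by (rule someI[of _ "(b, i)"]) (use that in simp)
    then show ?thesis
      unfolding h_def by (auto split: prod.splits intro!: well_defined that)
  qed
  show thesis
  proof (rule that[of C h])
    show "B \<subseteq> C" using CI[of _ 0] Bc by auto
    show "x \<in> C" using CI[of \<one> 1] x by simp
    show "subgroup C G"
    proof (rule subgroupI)
      show "C \<subseteq> carrier G" using Bc x by (auto simp: C_def)
      show "C \<noteq> {}" using \<open>x \<in> C\<close> by blast
      show "inv g \<in> C" if gC: "g \<in> C" for g
      proof -
        obtain b and i :: int where b: "b \<in> B" "g = b \<otimes> x [^] i" using CE[OF gC] by metis
        show ?thesis unfolding b(2) inv[OF b(1)] using b(1) x by (intro CI conj) simp_all
      qed
      show "g \<otimes> k \<in> C" if gk: "g \<in> C" "k \<in> C" for g k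
      proof -
        obtain b c and i j :: int
          where b: "b \<in> B" "g = b \<otimes> x [^] i" and c: "c \<in> B" "k = c \<otimes> x [^] j"
          using gk[THEN CE] by metis
        show ?thesis unfolding b(2) c(2) mult[OF b(1) c(1)] using b(1) c(1) x
          by (intro CI B.m_closed conj) simp_all
      qed
    qed
    show "additive_mod n G C h"
      unfolding additive_mod_def
    proof (intro ballI)
      fix g k assume "g \<in> C" "k \<in> C"
      then obtain b c and i j :: int
        where g: "b \<in> B" "g = b \<otimes> x [^] i" and k: "c \<in> B" "k = c \<otimes> x [^] j"
        using CE by metis
      have cB: "conj (x [^] i) c \<in> B" using conj k x by simp
      have "[h (g \<otimes> k) = f (b \<otimes> conj (x [^] i) c) + (i + j) * t] (mod int n)"
        unfolding g k mult[OF g(1) k(1)] using g cB by (intro h) simp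
      also have "[f (b \<otimes> conj (x [^] i) c) + (i + j) * t = (f b + f (conj (x [^] i) c)) + (i + j) * t] (mod int n)"
        using g cB by (intro cong_add fadd) auto
      also have "[(f b + f (conj (x [^] i) c)) + (i + j) * t = (f b + f c) + (i + j) * t] (mod int n)"
        using k x by (intro cong_add conj) auto
      also have "(f b + f c) + (i + j) * t = (f b + i * t) + (f c + j * t)"
        by (simp add: algebra_simps)
      also have "[(f b + i * t) + (f c + j * t) = h g + h k] (mod int n)"
        unfolding g(2) k(2) using g(1) k(1) by (intro cong_add h[THEN cong_sym])
      finally show "[h (g \<otimes> k) = h g + h k] (mod int n)" .
    qed
    show "[h b = f b] (mod int n)" if "b \<in> B" for b using h[OF that, of 0] Bc that by simp
    show "[h x = t] (mod int n)"
    proof -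
      have "[h x = f \<one> + t] (mod int n)" using h[of \<one> 1] x by simp
      also have "[f \<one> + t = 0 + t] (mod int n)"
        using additive_mod_one[OF B f] by (intro cong_add) auto
      finally show ?thesis by simp
    qed
  qed
qed

text \<open>The zero function on \<open>K\<close> extends to K<a> with value 1 at \<open>a\<close>.
  Among all extensions of this kind, one with a domain of maximal order must be defined on all of
  \<open>G\<close>, because any further element could be adjoined by
  \<open>additive_mod_extend\<close>.\<close>

lemma additive_mod_exists:
  assumes fin: "finite (carrier G)" and K: "subgroup K G" and D: "derived G (carrier G) \<subseteq> K"
    and n: "0 < n" "\<And>x. x \<in> carrier G \<Longrightarrow> x [^] n \<in> K"
    and a: "a \<in> carrier G" "\<And>k::nat. a [^] k \<in> K \<Longrightarrow> n dvd k"
  obtains f where "additive_mod n G (carrier G) f" "\<And>k. k \<in> K \<Longrightarrow> [f k = 0] (mod int n)"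
    "[f a = 1] (mod int n)"
proof -
  define good where "good B f \<longleftrightarrow> subgroup B G \<and> K \<subseteq> B \<and> additive_mod n G B f \<and>
    (\<forall>k\<in>K. [f k = 0] (mod int n)) \<and> a \<in> B \<and> [f a = 1] (mod int n)" for B f
  interpret K: subgroup K G by (rule K)
  have pow_neg: "x [^] m \<in> B" if "subgroup B G" "x \<in> carrier G" "x [^] (- int m) \<in> B" for x B and m :: nat
    using that subgroup.m_inv_closed[OF that(1,3)] by (simp add: int_pow_neg_int)
  have "\<exists>B f. good B f"
  proof -
    \<comment> \<open>Consistency of the zero function with the value 1 at \<open>a\<close>: a power
      of \<open>a\<close> lies in \<open>K\<close> only if its exponent is divisible by n.\<close>
    have t: "[(0::int) = i * 1] (mod int n)" if "a [^] i \<in> K" for i :: int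
    proof -
      have "int n dvd i"
      proof (cases i rule: int_cases2)
        case (nonneg m)
        then show ?thesis using that a(2)[of m] by (simp add: int_pow_int)
      next
        case (nonpos m)
        then show ?thesis using pow_neg[OF K a(1), of m] that a(2)[of m] by simp
      qed
      then show ?thesis by (simp add: cong_iff_dvd_diff)
    qed
    have z: "additive_mod n G K (\<lambda>_. 0)" by (simp add: additive_mod_def)
    obtain C h where "subgroup C G" "K \<subseteq> C" "a \<in> C" "additive_mod n G C h"
      "\<And>b. b \<in> K \<Longrightarrow> [h b = 0] (mod int n)" "[h a = 1] (mod int n)"
      using additive_mod_extend[OF K z D _ a(1), of 1] t by auto
    then have "good C h" by (simp add: good_def)
    then show ?thesis by blast
  qed
  then obtain B where ex: "\<exists>f. good B f" and max: "\<And>C. \<exists>f. good C f \<Longrightarrow> card C \<le> card B"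
    using ex_has_greatest_nat[of "\<lambda>B. \<exists>f. good B f" _ card "card (carrier G) + 1"] fin
    by (metis card_mono good_def less_Suc_eq_le Suc_eq_plus1 subgroup.subset)
  then obtain f where f: "good B f" by blast
  interpret B: subgroup B G using f good_def by blast
  have KB: "K \<subseteq> B" and fadd: "additive_mod n G B f" and aB: "a \<in> B" and fa: "[f a = 1] (mod int n)"
    and fK: "\<And>k. k \<in> K \<Longrightarrow> [f k = 0] (mod int n)"
    using f by (auto simp: good_def)
  have "carrier G \<subseteq> B"
  proof
    fix x assume x: "x \<in> carrier G"
    \<comment> \<open>\<open>k\<close> becomes the order of \<open>x\<close> modulo
      \<open>B\<close>. The value \<open>t\<close> at \<open>x\<close> must satisfy k t = f(x^k)
      modulo n, so f(x^k) has to be divisible by \<open>k\<close>.\<close>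
    define P where "P k \<longleftrightarrow> 0 < k \<and> x [^] k \<in> B" for k :: nat
    define k where "k = (LEAST k. P k)"
    have "P n" using n x KB by (auto simp: P_def)
    then have Pk: "P k" unfolding k_def by (rule LeastI)
    have kdvd: "k dvd i" if "x [^] i \<in> B" for i :: nat
    proof -
      have "x [^] i = (x [^] k) [^] (i div k) \<otimes> x [^] (i mod k)"
        using x by (simp add: nat_pow_pow nat_pow_mult)
      moreover have q: "(x [^] k) [^] (i div k) \<in> B"
        using Pk by (metis P_def subgroup_int_pow_closed int_pow_int B.subgroup_axioms)
      ultimately have "x [^] (i mod k) = inv ((x [^] k) [^] (i div k)) \<otimes> x [^] i"
        using x by (simp add: inv_solve_left)
      then have "x [^] (i mod k) \<in> B" using q that by simp
      then have "\<not> 0 < i mod k"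
        using not_less_Least[of "i mod k" P] Pk unfolding k_def P_def
        by (metis P_def k_def mod_less_divisor)
      then show ?thesis by (simp add: mod_eq_0_iff_dvd)
    qed
    have xk: "x [^] k \<in> B" "0 < k" using Pk by (auto simp: P_def)
    obtain m where m: "n = k * m" using kdvd[of n] \<open>P n\<close> by (auto simp: P_def)
    \<comment> \<open>With n = k m, additivity gives m f(x^k) = f(x^n) = 0 modulo k m, because x^n
      lies in \<open>K\<close>. Cancelling \<open>m\<close> yields the required
      divisibility.\<close>
    have "[int m * f (x [^] k) = f ((x [^] k) [^] m)] (mod int n)"
      using additive_mod_nat_pow[OF B.subgroup_axioms fadd xk(1)] cong_sym by blast
    also have "(x [^] k) [^] m = x [^] n" using x m by (simp add: nat_pow_pow)
    also have "[f (x [^] n) = 0] (mod int n)" using n x by (intro fK) auto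
    finally have "int m * int k dvd int m * f (x [^] k)" by (simp add: cong_0_iff m mult.commute)
    then have "int k dvd f (x [^] k)" using m n by auto
    then obtain t where t: "f (x [^] k) = int k * t" by blast
    have tnat: "[f (x [^] i) = int i * t] (mod int n)" if xi: "x [^] i \<in> B" for i :: nat
    proof -
      obtain l where l: "i = k * l" using kdvd[OF xi] by blast
      have "x [^] i = (x [^] k) [^] l" using x l by (simp add: nat_pow_pow)
      then show ?thesis
        using additive_mod_nat_pow[OF B.subgroup_axioms fadd xk(1), of l] t l
        by (simp add: mult_ac)
    qed
    \<comment> \<open>Negative exponents are reduced to natural ones by applying additivity to x^i
      x^(-i) = 1.\<close>
    have tint: "[f (x [^] i) = i * t] (mod int n)" if i: "x [^] i \<in> B" for i :: int
    proof (cases i rule: int_cases2)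
      case (nonneg m)
      then show ?thesis using tnat[of m] i by (simp add: int_pow_int)
    next
      case (nonpos m)
      have j: "x [^] m \<in> B" using pow_neg[OF B.subgroup_axioms x] i nonpos by blast
      have "x [^] i \<otimes> x [^] m = \<one>" using x by (simp add: nonpos int_pow_neg_int)
      moreover have "[f (x [^] i \<otimes> x [^] m) = f (x [^] i) + f (x [^] m)] (mod int n)"
        using fadd i j unfolding additive_mod_def by simp
      ultimately have "[f (x [^] i) + f (x [^] m) = 0] (mod int n)"
        using additive_mod_one[OF B.subgroup_axioms fadd] by (metis cong_trans cong_sym)
      moreover have "[f (x [^] m) = - i * t] (mod int n)" using tnat[OF j] nonpos by simp
      ultimately have "[(f (x [^] i) + f (x [^] m)) - f (x [^] m) = 0 - (- i * t)] (mod int n)"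
        by (rule cong_diff)
      then show ?thesis by simp
    qed
    have DB: "derived G (carrier G) \<subseteq> B" using D KB by (rule subset_trans)
    have fD: "[f d = 0] (mod int n)" if "d \<in> derived G (carrier G)" for d
      using D that by (intro fK) (rule subsetD)
    obtain C h where C: "subgroup C G" "B \<subseteq> C" "x \<in> C" "additive_mod n G C h"
      "\<And>b. b \<in> B \<Longrightarrow> [h b = f b] (mod int n)" "[h x = t] (mod int n)"
      using additive_mod_extend[OF B.subgroup_axioms fadd DB fD x tint] by metis
    have "good C h"
      unfolding good_def
    proof (intro conjI ballI)
      show "K \<subseteq> C" using KB C(2) by (rule subset_trans)
      show "a \<in> C" using C(2) aB by (rule subsetD)
      show "[h k = 0] (mod int n)" if "k \<in> K" for k
        using C(5)[OF subsetD[OF KB that]] fK[OF that] by (rule cong_trans)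
      show "[h a = 1] (mod int n)" using C(5)[OF aB] fa by (rule cong_trans)
    qed (fact C)+
    then have "card C \<le> card B" using max by blast
    moreover have "finite C" using subgroup.subset[OF C(1)] fin by (rule finite_subset)
    ultimately have "B = C" using C(2) by (intro card_seteq)
    then show "x \<in> B" using C(3) by simp
  qed
  then have "B = carrier G" using B.subset by blast
  then show thesis using that fadd fK fa by blast
qed

end

section \<open>The endomorphism monoid\<close>

lemma End_monoid_iff:
  "\<phi> \<in> carrier (End_monoid G) \<longleftrightarrow> \<phi> \<in> hom G G \<and> \<phi> \<in> extensional (carrier G)"
  by (simp add: End_monoid_def)

lemma auto_subset_End: "auto G \<subseteq> carrier (End_monoid G)"
  by (auto simp: auto_def Bij_def End_monoid_iff)

lemma End_mult_apply:
  assumes "x \<in> carrier G"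
  shows "(\<phi> \<otimes>\<^bsub>End_monoid G\<^esub> \<psi>) x = \<phi> (\<psi> x)"
  using assms by (simp add: End_monoid_def compose_def)

lemma (in group) End_apply:
  assumes "\<phi> \<in> carrier (End_monoid G)"
  shows "x \<in> carrier G \<Longrightarrow> \<phi> x \<in> carrier G"
    and "x \<in> carrier G \<Longrightarrow> y \<in> carrier G \<Longrightarrow> \<phi> (x \<otimes> y) = \<phi> x \<otimes> \<phi> y"
    and "\<phi> \<one> = \<one>"
    and "x \<in> carrier G \<Longrightarrow> \<phi> (inv x) = inv (\<phi> x)"
    and "x \<in> carrier G \<Longrightarrow> \<phi> (x [^] (i::int)) = \<phi> x [^] i"
proof -
  interpret group_hom G G \<phi>
    using assms by (simp add: group_hom_def group_hom_axioms_def End_monoid_iff)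
  show "x \<in> carrier G \<Longrightarrow> \<phi> x \<in> carrier G"
    and "x \<in> carrier G \<Longrightarrow> y \<in> carrier G \<Longrightarrow> \<phi> (x \<otimes> y) = \<phi> x \<otimes> \<phi> y"
    and "\<phi> \<one> = \<one>"
    and "x \<in> carrier G \<Longrightarrow> \<phi> (inv x) = inv (\<phi> x)"
    and "x \<in> carrier G \<Longrightarrow> \<phi> (x [^] (i::int)) = \<phi> x [^] i"
    by (simp_all add: hom_int_pow)
qed

lemma (in group) End_image_subgroup:
  assumes "\<phi> \<in> carrier (End_monoid G)"
  shows "subgroup (\<phi> ` carrier G) G"
proof -
  interpret group_hom G G \<phi>
    using assms by (simp add: group_hom_def group_hom_axioms_def End_monoid_iff)
  show ?thesis by (rule img_is_subgroup)
qed

lemma (in group) monoid_End: "monoid (End_monoid G)"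
proof (rule monoidI)
  fix \<phi> \<psi> \<chi>
  assume \<phi>: "\<phi> \<in> carrier (End_monoid G)" and \<psi>: "\<psi> \<in> carrier (End_monoid G)"
    and \<chi>: "\<chi> \<in> carrier (End_monoid G)"
  show "\<phi> \<otimes>\<^bsub>End_monoid G\<^esub> \<psi> \<in> carrier (End_monoid G)"
    using \<phi> \<psi> by (auto simp: End_monoid_def hom_def compose_def Pi_iff)
  show "\<phi> \<otimes>\<^bsub>End_monoid G\<^esub> \<psi> \<otimes>\<^bsub>End_monoid G\<^esub> \<chi> =
    \<phi> \<otimes>\<^bsub>End_monoid G\<^esub> (\<psi> \<otimes>\<^bsub>End_monoid G\<^esub> \<chi>)"
    using End_apply(1)[OF \<chi>] by (auto simp: End_monoid_def compose_def)
  show "\<one>\<^bsub>End_monoid G\<^esub> \<otimes>\<^bsub>End_monoid G\<^esub> \<phi> = \<phi>" "\<phi> \<otimes>\<^bsub>End_monoid G\<^esub> \<one>\<^bsub>End_monoid G\<^esub> = \<phi>"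
    using \<phi> End_apply(1)[OF \<phi>]
    by (auto simp: End_monoid_def compose_def extensional_def)
qed (auto simp: End_monoid_def hom_def)

lemma (in group) finite_End:
  assumes "finite (carrier G)"
  shows "finite (carrier (End_monoid G))"
proof (rule finite_subset)
  show "carrier (End_monoid G) \<subseteq> carrier G \<rightarrow>\<^sub>E carrier G"
    by (auto simp: End_monoid_def hom_def PiE_def)
  show "finite (carrier G \<rightarrow>\<^sub>E carrier G)" using assms by (intro finite_PiE)
qed

text \<open>By finiteness x^i = x^j for some i < j, so the powers of \<open>x\<close> from i on have
  period d = j - i. Any positive multiple n of d with n >= i then satisfies x^(2n) = x^n.\<close>

lemma (in monoid) exists_idempotent_power:
  assumes fin: "finite (carrier G)" and x: "x \<in> carrier G"
  obtains n :: nat where "0 < n" "x [^] n \<otimes> x [^] n = x [^] n"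
proof -
  have "\<not> inj_on (\<lambda>n::nat. x [^] n) UNIV"
    using fin x by (meson finite_imageD finite_subset image_subset_iff infinite_UNIV_nat nat_pow_closed)
  then obtain i j :: nat where ij: "i < j" "x [^] i = x [^] j"
    unfolding inj_on_def by (metis linorder_neqE_nat)
  define d where "d = j - i"
  have step: "x [^] (i + r + d) = x [^] (i + r)" for r
  proof -
    have "x [^] (i + r + d) = x [^] j \<otimes> x [^] r"
      using x ij(1) by (simp add: d_def nat_pow_mult add.commute)
    also have "\<dots> = x [^] (i + r)" using x ij(2) by (simp add: nat_pow_mult add.commute flip: ij(2))
    finally show ?thesis .
  qed
  have periodic: "x [^] (i + r + k * d) = x [^] (i + r)" for r k
  proof (induction k)
    case (Suc k)
    then show ?case using step[of "r + k * d"] by (simp add: add_ac)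
  qed simp
  \<comment> \<open>The factor is \<open>Suc i\<close> rather than \<open>i\<close>, so that
    \<open>n\<close> is positive even when \<open>i\<close> is 0.\<close>
  define n where "n = Suc i * d"
  have d: "0 < d" using ij(1) by (simp add: d_def)
  then have "i \<le> n" by (simp add: n_def trans_le_add2)
  then have "x [^] (n + n) = x [^] n"
    using periodic[of "n - i" "Suc i"] by (simp add: n_def)
  moreover have "0 < n" using d by (simp add: n_def)
  ultimately show thesis using that[of n] x by (simp add: nat_pow_mult)
qed

section \<open>Inner automorphisms and centrality of the commutator subgroup\<close>

lemma commute_apply:
  assumes "\<alpha> \<in> center (End_monoid G)" "\<phi> \<in> carrier (End_monoid G)" "x \<in> carrier G"
  shows "\<alpha> (\<phi> x) = \<phi> (\<alpha> x)"
proof -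
  have "\<alpha> \<otimes>\<^bsub>End_monoid G\<^esub> \<phi> = \<phi> \<otimes>\<^bsub>End_monoid G\<^esub> \<alpha>"
    using assms by (simp add: center_def)
  then show ?thesis using assms(3) End_mult_apply by metis
qed

context group
begin

lemma finite_inj_End_auto:
  assumes "finite (carrier G)" "\<phi> \<in> carrier (End_monoid G)" "inj_on \<phi> (carrier G)"
  shows "\<phi> \<in> auto G"
proof -
  have "\<phi> ` carrier G = carrier G"
    using assms End_apply(1)[OF assms(2)] by (intro endo_inj_surj) auto
  then show ?thesis
    using assms by (auto simp: auto_def Bij_def End_monoid_iff bij_betw_def)
qed

lemma End_inj_onI:
  assumes \<phi>: "\<phi> \<in> carrier (End_monoid G)" and ker: "\<And>g. g \<in> carrier G \<Longrightarrow> \<phi> g = \<one> \<Longrightarrow> g = \<one>"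
  shows "inj_on \<phi> (carrier G)"
proof (rule inj_onI)
  fix x y assume x: "x \<in> carrier G" and y: "y \<in> carrier G" and eq: "\<phi> x = \<phi> y"
  have "\<phi> (x \<otimes> inv y) = \<one>" using x y eq by (simp add: End_apply[OF \<phi>])
  then have "x \<otimes> inv y = \<one>" using x y by (intro ker[of "x \<otimes> inv y"]) simp_all
  then have "x \<otimes> inv y \<otimes> y = y" using y by simp
  then show "x = y" using x y by (simp add: m_assoc)
qed

lemma inner_auto:
  assumes fin: "finite (carrier G)" and g: "g \<in> carrier G"
  shows "(\<lambda>x\<in>carrier G. g \<otimes> x \<otimes> inv g) \<in> auto G" (is "?c \<in> _")
proof (rule finite_inj_End_auto[OF fin])
  show c: "?c \<in> carrier (End_monoid G)"
    using g by (auto simp: End_monoid_iff hom_def m_assoc inv_mult_cancel)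
  show "inj_on ?c (carrier G)"
  proof (rule inj_onI)
    fix x y assume xy: "x \<in> carrier G" "y \<in> carrier G" "?c x = ?c y"
    then have "g \<otimes> (x \<otimes> inv g) = g \<otimes> (y \<otimes> inv g)" using g by (simp add: m_assoc)
    then show "x = y" using xy g by simp
  qed
qed

lemma center_subgroup: "subgroup (center G) G"
proof (rule subgroupI)
  show "center G \<subseteq> carrier G" by (auto simp: center_def)
  show "center G \<noteq> {}" by (auto simp: center_def intro!: exI[of _ \<one>])
  show "inv z \<in> center G" if "z \<in> center G" for z
  proof -
    have z: "z \<in> carrier G" "\<And>x. x \<in> carrier G \<Longrightarrow> z \<otimes> x = x \<otimes> z"
      using that by (auto simp: center_def)
    have "inv z \<otimes> x = x \<otimes> inv z" if x: "x \<in> carrier G" for x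
    proof -
      have "inv z \<otimes> x = inv z \<otimes> (x \<otimes> z) \<otimes> inv z" using x z(1) by (simp add: m_assoc)
      also have "\<dots> = x \<otimes> inv z" using x z(1) by (simp add: inv_mult_cancel flip: z(2))
      finally show ?thesis .
    qed
    then show ?thesis using z(1) by (simp add: center_def)
  qed
  show "y \<otimes> z \<in> center G" if "y \<in> center G" "z \<in> center G" for y z
  proof -
    have yz: "y \<in> carrier G" "z \<in> carrier G" "\<And>x. x \<in> carrier G \<Longrightarrow> z \<otimes> x = x \<otimes> z"
      "\<And>x. x \<in> carrier G \<Longrightarrow> y \<otimes> x = x \<otimes> y"
      using that by (auto simp: center_def)
    have "y \<otimes> z \<otimes> x = x \<otimes> (y \<otimes> z)" if x: "x \<in> carrier G" for x
    proof -
      have "y \<otimes> z \<otimes> x = y \<otimes> (x \<otimes> z)" using x yz(1,2) yz(3)[OF x] by (simp add: m_assoc)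
      also have "\<dots> = y \<otimes> x \<otimes> z" using x yz(1,2) by (simp add: m_assoc)
      also have "\<dots> = x \<otimes> y \<otimes> z" using yz(4)[OF x] by simp
      finally show ?thesis using x yz(1,2) by (simp add: m_assoc)
    qed
    then show ?thesis using yz(1,2) by (simp add: center_def)
  qed
qed

text \<open>Inner automorphisms are central in the endomorphism monoid, so they commute with each
  other and gh and hg induce the same conjugation. Their quotient gh(hg)^(-1), which is the
  commutator of g and h, therefore centralizes \<open>G\<close>.\<close>

lemma derived_subset_center:
  assumes fin: "finite (carrier G)" and aut: "auto G \<subseteq> center (End_monoid G)"
  shows "derived G (carrier G) \<subseteq> center G"
  unfolding derived_def
proof (rule generate_subgroup_incl[OF _ center_subgroup], safe)
  fix g h assume g: "g \<in> carrier G" and h: "h \<in> carrier G"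
  define u v where "u = g \<otimes> h" and "v = h \<otimes> g"
  have uv: "u \<in> carrier G" "v \<in> carrier G" using g h by (auto simp: u_def v_def)
  have conj_eq: "u \<otimes> y \<otimes> inv u = v \<otimes> y \<otimes> inv v" if y: "y \<in> carrier G" for y
  proof -
    have "(\<lambda>x\<in>carrier G. h \<otimes> x \<otimes> inv h) \<in> carrier (End_monoid G)"
      using inner_auto[OF fin h] auto_subset_End by blast
    with commute_apply[OF subsetD[OF aut inner_auto[OF fin g]] this y]
    show ?thesis using g h y by (simp add: u_def v_def m_assoc inv_mult_group)
  qed
  have "u \<otimes> inv v \<otimes> x = x \<otimes> (u \<otimes> inv v)" if x: "x \<in> carrier G" for x
  proof -
    \<comment> \<open>This choice of \<open>y\<close> makes its conjugate by \<open>v\<close> equal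
      to \<open>x\<close>; by \<open>conj_eq\<close>, its conjugate by \<open>u\<close> is then
      \<open>x\<close> as well.\<close>
    define y where "y = inv v \<otimes> x \<otimes> v"
    have y: "y \<in> carrier G" using x uv by (simp add: y_def)
    have "v \<otimes> y \<otimes> inv v = x" using x uv by (simp add: y_def m_assoc inv_mult_cancel)
    then have "u \<otimes> y = x \<otimes> u" using conj_eq[OF y] uv x y by (metis inv_solve_right m_closed)
    then have "u \<otimes> y \<otimes> inv v = x \<otimes> (u \<otimes> inv v)" using uv x y by (simp add: m_assoc)
    then show ?thesis using uv x by (simp add: y_def m_assoc)
  qed
  then have "u \<otimes> inv v \<in> center G" using uv by (simp add: center_def)
  then show "g \<otimes> h \<otimes> inv g \<otimes> inv h \<in> center G"
    using g h by (simp add: u_def v_def inv_mult_group m_assoc)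
qed

section \<open>Endomorphisms with cyclic image\<close>

lemma int_pow_cong:
  assumes "x \<in> carrier G" "x [^] n = \<one>" "[i = j] (mod int n)"
  shows "x [^] i = x [^] j"
proof -
  obtain k where "i = j + int n * k"
    using assms(3) by (metis cong_iff_lin cong_sym)
  then have "x [^] i = x [^] j \<otimes> (x [^] int n) [^] k"
    using assms(1) by (simp add: int_pow_mult int_pow_pow)
  then show ?thesis using assms(1,2) by (simp add: int_pow_int)
qed

lemma additive_mod_pow_End:
  assumes f: "additive_mod n G (carrier G) f" and x: "x \<in> carrier G" "x [^] n = \<one>"
  shows "(\<lambda>g\<in>carrier G. x [^] f g) \<in> carrier (End_monoid G)"
proof -
  have "x [^] f (g \<otimes> h) = x [^] f g \<otimes> x [^] f h" if "g \<in> carrier G" "h \<in> carrier G" for g h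
    using int_pow_cong[OF x, of "f (g \<otimes> h)" "f g + f h"] f that x(1)
    by (simp add: additive_mod_def int_pow_mult)
  then show ?thesis using x(1) by (auto simp: End_monoid_iff hom_def)
qed

text \<open>By Bezout, \<open>K\<close> also contains the power of \<open>a\<close> with exponent
  gcd(k, p^(d+1)), which is some p^j. If j <= d, then a^(p^d) would be a power of that element and
  lie in \<open>K\<close>.\<close>

lemma prime_power_dvd_if_pow_mem:
  assumes p: "prime (p::nat)" and K: "subgroup K G" and a: "a \<in> carrier G"
    and e: "a [^] (p ^ Suc d) \<in> K" and d: "a [^] (p ^ d) \<notin> K" and k: "a [^] (k::nat) \<in> K"
  shows "p ^ Suc d dvd k"
proof -
  obtain j where j: "gcd k (p ^ Suc d) = p ^ j" "j \<le> Suc d"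
    using divides_primepow_nat[OF p] gcd_dvd2 by blast
  obtain u v :: int where uv: "u * int k + v * int (p ^ Suc d) = gcd (int k) (int (p ^ Suc d))"
    using bezout_int by blast
  have "a [^] (u * int k + v * int (p ^ Suc d)) = (a [^] k) [^] u \<otimes> (a [^] (p ^ Suc d)) [^] v"
    using a by (simp only: int_pow_mult int_pow_closed int_pow_pow mult.commute flip: int_pow_int)
  moreover have "u * int k + v * int (p ^ Suc d) = int (p ^ j)"
    using uv j(1) by (metis gcd_int_int_eq)
  ultimately have "a [^] (p ^ j) = (a [^] k) [^] u \<otimes> (a [^] (p ^ Suc d)) [^] v"
    by (simp only: int_pow_int)
  then have aj: "a [^] (p ^ j) \<in> K"
    using subgroup_int_pow_closed[OF K] k e subgroup.m_closed[OF K] by metis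
  have "j = Suc d"
  proof (rule ccontr)
    assume "j \<noteq> Suc d"
    then have "p ^ d = p ^ j * p ^ (d - j)" using j(2) by (simp flip: power_add)
    then have "a [^] (p ^ d) = (a [^] (p ^ j)) [^] (p ^ (d - j))" using a by (simp add: nat_pow_pow)
    then have "a [^] (p ^ d) \<in> K"
      using subgroup_int_pow_closed[OF K aj] by (metis int_pow_int)
    then show False using d by blast
  qed
  then show ?thesis using j(1) by (metis gcd_dvd1)
qed

text \<open>Minimality of \<open>e\<close> provides an \<open>a\<close> of order exactly p^e modulo
  \<open>K\<close>, and \<open>additive_mod_exists\<close> then provides \<open>f\<close>. The
  endomorphism is g \<mapsto> x^(f g). Neither \<open>a\<close> nor \<open>f\<close> depends on
  \<open>x\<close>.\<close>

lemma exists_End_mapping_to: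
  assumes fin: "finite (carrier G)" and p: "prime (p::nat)"
    and K: "subgroup K G" and D: "derived G (carrier G) \<subseteq> K"
    and e: "\<And>x. x \<in> carrier G \<Longrightarrow> x [^] (p ^ e) \<in> K"
    and min: "\<And>d. d < e \<Longrightarrow> \<exists>x\<in>carrier G. x [^] (p ^ d) \<notin> K"
  obtains a where "a \<in> carrier G"
    "\<And>x. x \<in> carrier G \<Longrightarrow> x [^] (p ^ e) = \<one> \<Longrightarrow>
      \<exists>\<phi>\<in>carrier (End_monoid G). \<phi> a = x \<and> (\<forall>k\<in>K. \<phi> k = \<one>) \<and>
        (\<forall>g\<in>carrier G. \<exists>i::int. \<phi> g = x [^] i)"
proof -
  obtain a where a: "a \<in> carrier G" "\<And>k::nat. a [^] k \<in> K \<Longrightarrow> p ^ e dvd k"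
  proof (cases e)
    \<comment> \<open>Here p^e = 1 divides every exponent, so any element can serve as
      \<open>a\<close>.\<close>
    case 0
    then show thesis using that[of \<one>] by simp
  next
    case (Suc d)
    then obtain a where a: "a \<in> carrier G" "a [^] (p ^ d) \<notin> K" using min[of d] by auto
    show thesis
    proof (rule that[OF a(1)])
      show "p ^ e dvd k" if k: "a [^] k \<in> K" for k
        using prime_power_dvd_if_pow_mem[OF p K a(1) _ a(2) k] e[OF a(1)] unfolding Suc by simp
    qed
  qed
  have pe: "0 < p ^ e" using p by (simp add: prime_gt_0_nat)
  obtain f where f: "additive_mod (p ^ e) G (carrier G) f"
    "\<And>k. k \<in> K \<Longrightarrow> [f k = 0] (mod int (p ^ e))" "[f a = 1] (mod int (p ^ e))"
    using additive_mod_exists[OF fin K D pe e a] by metis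
  show thesis
  proof (rule that[OF a(1)])
    fix x assume x: "x \<in> carrier G" "x [^] (p ^ e) = \<one>"
    have "x [^] f a = x" using int_pow_cong[OF x f(3)] x by simp
    moreover have "x [^] f k = \<one>" if "k \<in> K" for k using int_pow_cong[OF x f(2)[OF that]] by simp
    ultimately show "\<exists>\<phi>\<in>carrier (End_monoid G). \<phi> a = x \<and> (\<forall>k\<in>K. \<phi> k = \<one>) \<and>
        (\<forall>g\<in>carrier G. \<exists>i::int. \<phi> g = x [^] i)"
      using additive_mod_pow_End[OF f(1) x] a(1) subgroup.mem_carrier[OF K]
      by (intro bexI[of _ "\<lambda>g\<in>carrier G. x [^] f g"]) auto
  qed
qed

end

lemma set_mult_iff: "g \<in> A <#>\<^bsub>G\<^esub> B \<longleftrightarrow> (\<exists>a\<in>A. \<exists>b\<in>B. g = a \<otimes>\<^bsub>G\<^esub> b)"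
  by (simp add: set_mult_def)

context group
begin

section \<open>Invariance of images of endomorphisms\<close>

text \<open>Commutation gives \<alpha>(\<phi>(G)) = \<phi>(\<alpha>(G)), and \<alpha>(G) =
  G.\<close>

lemma image_characteristic:
  assumes aut: "auto G \<subseteq> center (End_monoid G)" and \<phi>: "\<phi> \<in> carrier (End_monoid G)"
  shows "characteristic (\<phi> ` carrier G) G"
  unfolding characteristic_def
proof (intro conjI ballI End_image_subgroup[OF \<phi>])
  fix \<alpha> assume \<alpha>: "\<alpha> \<in> auto G"
  have "\<alpha> ` \<phi> ` carrier G = \<phi> ` \<alpha> ` carrier G"
    unfolding image_image using commute_apply[OF subsetD[OF aut \<alpha>] \<phi>] by (rule image_cong[OF refl])
  also have "\<alpha> ` carrier G = carrier G" using \<alpha> by (auto simp: auto_def Bij_def bij_betw_def)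
  finally show "\<alpha> ` \<phi> ` carrier G = \<phi> ` carrier G" .
qed

lemma image_fully_invariant:
  assumes comm: "comm_monoid (End_monoid G)" and \<phi>: "\<phi> \<in> carrier (End_monoid G)"
  shows "fully_invariant (\<phi> ` carrier G) G"
  unfolding fully_invariant_def
proof (intro conjI ballI subsetI End_image_subgroup[OF \<phi>])
  fix \<psi> y assume \<psi>: "\<psi> \<in> carrier (End_monoid G)" and "y \<in> \<psi> ` \<phi> ` carrier G"
  then obtain x where x: "x \<in> carrier G" "y = \<psi> (\<phi> x)" by blast
  have "\<psi> \<in> center (End_monoid G)"
    using comm_monoid.m_comm[OF comm \<psi>] \<psi> by (simp add: center_def)
  then have "y = \<phi> (\<psi> x)" using commute_apply \<phi> x by metis
  then show "y \<in> \<phi> ` carrier G" using End_apply(1)[OF \<psi> x(1)] by simp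
qed

text \<open>Powers of cosets are cosets of powers. This form replaces computation in G/G' by
  membership of powers in G'.\<close>

lemma group_exponent_quotient:
  assumes "N \<lhd> G"
  shows "group_exponent (G Mod N) = (LEAST n. 0 < n \<and> (\<forall>x\<in>carrier G. x [^] n \<in> N))"
proof -
  interpret N: normal N G by (rule assms)
  have "(N #> x) [^]\<^bsub>G Mod N\<^esub> n = \<one>\<^bsub>G Mod N\<^esub> \<longleftrightarrow> x [^] n \<in> N" if x: "x \<in> carrier G" for x and n :: nat
  proof -
    have "(N #> x) [^]\<^bsub>G Mod N\<^esub> n = N #> (x [^] n)" using N.FactGroup_pow[OF x] by simp
    moreover have "N #> (x [^] n) = N \<longleftrightarrow> x [^] n \<in> N"
      using x rcos_self[OF _ N.subgroup_axioms, of "x [^] n"] coset_join2[OF _ N.subgroup_axioms, of "x [^] n"]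
      by auto
    ultimately show ?thesis by (simp add: FactGroup_def)
  qed
  then show ?thesis by (simp add: group_exponent_def carrier_FactGroup)
qed

end

section \<open>Finite p-groups: cyclic images, elements of order p, idempotent endomorphisms\<close>

context
  fixes G :: "('a, 'b) monoid_scheme" (structure) and p :: nat
  assumes p: "prime p" and pG: "finite_p_group p G"
begin

interpretation group G using pG by (simp add: finite_p_group_def)

lemma p_group_finite: "finite (carrier G)"
  using pG by (simp add: finite_p_group_def)

lemma p_group_exponent: "\<exists>n. \<forall>x\<in>carrier G. x [^] (p ^ n) = \<one>"
proof -
  obtain n where "order G = p ^ n" using pG by (auto simp: finite_p_group_def)
  then show ?thesis using pow_order_eq_1 by metis
qed

text \<open>Undoing the logarithm identifies p^e with the least positive n for which all n-th powers
  lie in G'. The two conclusions are what \<open>exists_End_mapping_to\<close> requires of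
  \<open>e\<close> when K = G'.\<close>

lemma abelianization_exponent:
  assumes e: "real e = log (real p) (real (group_exponent (G Mod derived G (carrier G))))"
  shows "\<And>x. x \<in> carrier G \<Longrightarrow> x [^] (p ^ e) \<in> derived G (carrier G)"
    and "\<And>d. d < e \<Longrightarrow> \<exists>x\<in>carrier G. x [^] (p ^ d) \<notin> derived G (carrier G)"
proof -
  let ?D = "derived G (carrier G)"
  let ?P = "\<lambda>n::nat. 0 < n \<and> (\<forall>x\<in>carrier G. x [^] n \<in> ?D)"
  have p1: "1 < p" using p by (rule prime_gt_1_nat)
  have exp: "group_exponent (G Mod ?D) = Least ?P"
    by (rule group_exponent_quotient[OF derived_self_is_normal])
  obtain n where n: "\<And>x. x \<in> carrier G \<Longrightarrow> x [^] (p ^ n) = \<one>" using p_group_exponent by blast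
  have "?P (p ^ n)"
    using n p1 subgroup.one_closed[OF derived_is_subgroup[OF subset_refl]] by simp
  then have P: "?P (Least ?P)" by (rule LeastI)
  have "real (p ^ e) = real p powr real e" using p1 by (simp add: powr_realpow)
  also have "\<dots> = real (Least ?P)" unfolding e exp using P p1 by (intro powr_log_cancel) auto
  finally have pe: "p ^ e = Least ?P" by (simp only: of_nat_eq_iff)
  show "x [^] (p ^ e) \<in> ?D" if "x \<in> carrier G" for x using P that pe by simp
  show "\<exists>x\<in>carrier G. x [^] (p ^ d) \<notin> ?D" if "d < e" for d
  proof -
    have "p ^ d < Least ?P" using that p1 unfolding pe[symmetric] by (rule power_strict_increasing)
    then have "\<not> ?P (p ^ d)" by (rule not_less_Least)
    then show ?thesis using p1 by auto
  qed
qed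

text \<open>A generator \<open>c\<close> of \<open>C\<close> satisfies c^(p^e) = 1, so some
  endomorphism takes values in the powers of \<open>c\<close> and sends some \<open>a\<close> to
  \<open>c\<close>. The powers of \<open>a\<close> already map onto \<open>C\<close>.\<close>

lemma cyclic_is_End_image:
  assumes e: "real e = log (real p) (real (group_exponent (G Mod derived G (carrier G))))"
    and C: "cyclic_subgroup C G" "card C dvd p ^ e"
  shows "\<exists>\<phi>\<in>carrier (End_monoid G). \<phi> ` carrier G = C"
proof -
  have CG: "subgroup C G" and cyc: "cyclic_group (G\<lparr>carrier := C\<rparr>)"
    using C(1) by (auto simp: cyclic_subgroup_def)
  interpret CC: group "G\<lparr>carrier := C\<rparr>" by (rule subgroup_imp_group[OF CG])
  obtain c where c: "c \<in> C" "C = range (\<lambda>i::int. c [^]\<^bsub>G\<lparr>carrier := C\<rparr>\<^esub> i)"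
    using cyc unfolding CC.cyclic_group by auto
  then have C_eq: "C = range (\<lambda>i::int. c [^] i)" using int_pow_consistent[OF CG c(1)] by simp
  have cG: "c \<in> carrier G" using c(1) CG subgroup.mem_carrier by metis
  have "c [^] card C = \<one>"
    using CC.pow_order_eq_1[of c] c(1) nat_pow_consistent[of c "card C" C] by (simp add: order_def)
  then have "c [^] (p ^ e) = \<one>" using C(2) cG by (metis dvdE nat_pow_one nat_pow_pow)
  with abelianization_exponent[OF e] obtain a \<phi> where a: "a \<in> carrier G"
    and \<phi>: "\<phi> \<in> carrier (End_monoid G)" "\<phi> a = c" "\<And>g. g \<in> carrier G \<Longrightarrow> \<exists>i::int. \<phi> g = c [^] i"
    using exists_End_mapping_to[OF p_group_finite p derived_is_subgroup[OF subset_refl] subset_refl, of e] cG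
    by metis
  have "\<phi> ` carrier G = C"
  proof
    show "\<phi> ` carrier G \<subseteq> C" unfolding C_eq using \<phi>(3) by blast
    have "c [^] i = \<phi> (a [^] i)" for i :: int using End_apply(5)[OF \<phi>(1) a] \<phi>(2) by simp
    then show "C \<subseteq> \<phi> ` carrier G" unfolding C_eq using a by blast
  qed
  then show ?thesis using \<phi>(1) by blast
qed

text \<open>As G' is central, G = G' forces \<open>G\<close> to be abelian and hence G' to be
  trivial. This settles the degenerate case e = 0 below.\<close>

lemma derived_eq_carrier_imp_trivial:
  assumes aut: "auto G \<subseteq> center (End_monoid G)" and perfect: "carrier G \<subseteq> derived G (carrier G)"
  shows "carrier G = {\<one>}"
proof -
  have "carrier G \<subseteq> center G"
    using perfect derived_subset_center[OF p_group_finite aut] by (rule subset_trans)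
  then have "comm_group G" by (intro group_comm_groupI) (auto simp: center_def)
  then have "derived G (carrier G) = {\<one>}" by (intro comm_group.derived_eq_singleton) auto
  then show ?thesis using perfect by auto
qed

text \<open>Let \<phi> map \<open>a\<close> to \<open>x\<close> with values in the powers of
  \<open>x\<close>. Since \<phi> commutes with conjugation by g, the element g x g^(-1) equals
  \<phi>(g a g^(-1)), which is the conjugate of \<open>x\<close> by the power \<phi>(g) of
  \<open>x\<close>, hence \<open>x\<close> itself.\<close>

lemma elements_of_order_p_central:
  assumes e: "real e = log (real p) (real (group_exponent (G Mod derived G (carrier G))))"
    and aut: "auto G \<subseteq> center (End_monoid G)"
    and x: "x \<in> carrier G" "x [^] p = \<one>"
  shows "x \<in> center G"
proof (cases "e = 0")
  case True
  then have "carrier G = {\<one>}"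
    using abelianization_exponent(1)[OF e] by (intro derived_eq_carrier_imp_trivial[OF aut]) auto
  then show ?thesis using x by (auto simp: center_def)
next
  case False
  then obtain d where "e = Suc d" using not0_implies_Suc by blast
  \<comment> \<open>Because e > 0, the relation x^p = 1 implies x^(p^e) = 1, as needed to make
    \<open>x\<close> a value of \<phi>.\<close>
  then have "x [^] (p ^ e) = (x [^] p) [^] (p ^ d)" using x(1) by (simp add: nat_pow_pow)
  then have xe: "x [^] (p ^ e) = \<one>" using x(2) by simp
  with abelianization_exponent[OF e] obtain a \<phi> where a: "a \<in> carrier G"
    and \<phi>: "\<phi> \<in> carrier (End_monoid G)" "\<phi> a = x" "\<And>g. g \<in> carrier G \<Longrightarrow> \<exists>i::int. \<phi> g = x [^] i"
    using exists_End_mapping_to[OF p_group_finite p derived_is_subgroup[OF subset_refl] subset_refl, of e] x(1)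
    by metis
  have "x \<otimes> g = g \<otimes> x" if g: "g \<in> carrier G" for g
  proof -
    have "g \<otimes> x \<otimes> inv g = \<phi> (g \<otimes> a \<otimes> inv g)"
      using commute_apply[OF subsetD[OF aut inner_auto[OF p_group_finite g]] \<phi>(1) a] g a x(1) \<phi>(2)
      by simp
    also have "\<dots> = \<phi> g \<otimes> x \<otimes> inv (\<phi> g)" using g a x(1) \<phi>(2) by (simp add: End_apply[OF \<phi>(1)])
    also have "\<dots> = x"
    proof -
      obtain i :: int where i: "\<phi> g = x [^] i" using \<phi>(3)[OF g] by blast
      have "x [^] i \<otimes> x = x \<otimes> x [^] i"
        using x(1) int_pow_mult[of x i 1] int_pow_mult[of x 1 i] by (simp add: add.commute)
      then show ?thesis unfolding i using x(1) by (simp add: m_assoc)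
    qed
    finally show ?thesis using g x(1) by (metis inv_solve_right m_closed)
  qed
  then show ?thesis using x(1) by (simp add: center_def)
qed

lemma Omega1_central:
  assumes e: "real e = log (real p) (real (group_exponent (G Mod derived G (carrier G))))"
    and aut: "auto G \<subseteq> center (End_monoid G)"
  shows "Omega1 p G \<subseteq> center G"
  unfolding Omega1_def
proof (rule generate_subgroup_incl[OF _ center_subgroup], safe)
  fix x assume "x \<in> carrier G" "p = ord x"
  then show "x \<in> center G" using elements_of_order_p_central[OF e aut] pow_ord_eq_1 by metis
qed

text \<open>If p^k is the order of a nontrivial \<open>h\<close> in \<open>H\<close>, then k > 0 and
  h^(p^(k-1)) has the required properties.\<close>

lemma exists_order_p:
  assumes "subgroup H G" "H \<noteq> {\<one>}"
  obtains x where "x \<in> H" "x \<noteq> \<one>" "x [^] p = \<one>"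
proof -
  interpret H: subgroup H G by fact
  obtain h where h: "h \<in> H" "h \<noteq> \<one>" using assms(2) H.one_closed by blast
  obtain n where n: "h [^] (p ^ n) = \<one>" using p_group_exponent h(1) by (metis H.mem_carrier)
  define k where "k = (LEAST k. h [^] (p ^ k) = \<one>)"
  have k: "h [^] (p ^ k) = \<one>" unfolding k_def using n by (rule LeastI)
  have "k \<noteq> 0" using k h by (auto intro: ccontr)
  then obtain d where d: "k = Suc d" using not0_implies_Suc by blast
  show thesis
  proof (rule that[of "h [^] (p ^ d)"])
    show "h [^] (p ^ d) \<in> H" using subgroup_int_pow_closed[OF assms(1) h(1)] by (metis int_pow_int)
    show "h [^] (p ^ d) \<noteq> \<one>" using not_less_Least[of d "\<lambda>k. h [^] (p ^ k) = \<one>"] d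
      by (simp add: k_def)
    show "(h [^] (p ^ d)) [^] p = \<one>" using k h(1) by (simp add: d nat_pow_pow mult.commute)
  qed
qed

lemma no_proper_idempotent_endo:
  assumes e: "real e = log (real p) (real (group_exponent (G Mod derived G (carrier G))))"
    and aut: "auto G \<subseteq> center (End_monoid G)"
    and \<pi>: "\<pi> \<in> carrier (End_monoid G)"
    and idem: "\<And>g. g \<in> carrier G \<Longrightarrow> \<pi> (\<pi> g) = \<pi> g"
  shows "\<pi> ` carrier G = {\<one>} \<or> (\<forall>g\<in>carrier G. \<pi> g = g)"
proof (rule ccontr)
  assume contra: "\<not> ?thesis"
  define H where "H = \<pi> ` carrier G"
  have H: "subgroup H G" unfolding H_def by (rule End_image_subgroup[OF \<pi>])
  interpret H: subgroup H G by (rule H)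
  have \<pi>H: "\<pi> h = h" if "h \<in> H" for h using that idem by (auto simp: H_def)
  obtain x where x: "x \<in> H" "x \<noteq> \<one>" "x [^] p = \<one>"
    using exists_order_p[OF H] contra H_def by blast
  have xG: "x \<in> carrier G" using x(1) by simp
  have x_comm: "x \<otimes> g = g \<otimes> x" if "g \<in> carrier G" for g
    using elements_of_order_p_central[OF e aut xG x(3)] that by (simp add: center_def)
  define D where "D = derived G (carrier G)"
  have Dn: "D \<lhd> G" unfolding D_def by (rule derived_self_is_normal)
  interpret D: normal D G by (rule Dn)
  define K where "K = D <#> H"
  have K: "subgroup K G" unfolding K_def by (rule mult_norm_subgroup[OF Dn H])
  have DK: "D \<subseteq> K"
  proof
    fix d assume d: "d \<in> D"
    show "d \<in> K" unfolding K_def set_mult_iff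
      by (rule bexI[OF _ d], rule bexI[OF _ H.one_closed]) (use d in simp)
  qed
  have HK: "H \<subseteq> K"
  proof
    fix h assume h: "h \<in> H"
    show "h \<in> K" unfolding K_def set_mult_iff
      by (rule bexI[OF _ D.one_closed], rule bexI[OF _ h]) (use h in simp)
  qed
  \<comment> \<open>If G = G'H with G' central, then every commutator of \<open>G\<close> is a
    commutator of elements of \<open>H\<close>. So G' lies in \<open>H\<close>, hence G = H, and
    \<pi> would be the identity.\<close>
  have "K \<noteq> carrier G"
  proof
    assume "K = carrier G"
    have "D \<subseteq> H"
      unfolding D_def derived_def
    proof (rule generate_subgroup_incl[OF _ H], safe)
      fix g1 g2 assume g: "g1 \<in> carrier G" "g2 \<in> carrier G"
      obtain d1 h1 where 1: "d1 \<in> D" "h1 \<in> H" "g1 = d1 \<otimes> h1"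
        using g(1) unfolding \<open>K = carrier G\<close>[symmetric] K_def set_mult_iff by metis
      obtain d2 h2 where 2: "d2 \<in> D" "h2 \<in> H" "g2 = d2 \<otimes> h2"
        using g(2) unfolding \<open>K = carrier G\<close>[symmetric] K_def set_mult_iff by metis
      have hG: "h1 \<in> carrier G" "h2 \<in> carrier G" using 1 2 by auto
      have cen: "\<And>d y. d \<in> D \<Longrightarrow> y \<in> carrier G \<Longrightarrow> d \<otimes> y = y \<otimes> d"
        using derived_subset_center[OF p_group_finite aut] unfolding D_def center_def by blast
      \<comment> \<open>A central factor \<open>d\<close> has no effect on conjugation. This is used
        twice below, to replace \<open>g1\<close> by \<open>h1\<close> and then \<open>g2\<close> by
        \<open>h2\<close> in the commutator.\<close>
      have conj: "(d \<otimes> h) \<otimes> y \<otimes> inv (d \<otimes> h) = h \<otimes> y \<otimes> inv h"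
        if d: "d \<in> D" and h: "h \<in> carrier G" and y: "y \<in> carrier G" for d h y
      proof -
        have dG: "d \<in> carrier G" using d by simp
        have "(d \<otimes> h) \<otimes> y \<otimes> inv (d \<otimes> h) = (d \<otimes> (h \<otimes> y \<otimes> inv h)) \<otimes> inv d"
          using dG h y by (simp add: m_assoc inv_mult_group)
        also have "\<dots> = h \<otimes> y \<otimes> inv h"
          using dG h y by (simp add: cen[OF d] m_assoc)
        finally show ?thesis .
      qed
      have "g1 \<otimes> g2 \<otimes> inv g1 \<otimes> inv g2 = (h1 \<otimes> g2 \<otimes> inv h1) \<otimes> inv g2"
        using conj[OF 1(1) hG(1) g(2)] 1(3) by simp
      also have "\<dots> = h1 \<otimes> (g2 \<otimes> inv h1 \<otimes> inv g2)" using hG g by (simp add: m_assoc)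
      also have "\<dots> = h1 \<otimes> (h2 \<otimes> inv h1 \<otimes> inv h2)"
        using conj[OF 2(1) hG(2), of "inv h1"] 2(3) hG(1) by simp
      finally show "g1 \<otimes> g2 \<otimes> inv g1 \<otimes> inv g2 \<in> H" using 1(2) 2(2) by simp
    qed
    then have "g \<in> H" if "g \<in> carrier G" for g
      using that unfolding \<open>K = carrier G\<close>[symmetric] K_def set_mult_iff by (metis H.m_closed subsetD)
    then show False using contra \<pi>H by metis
  qed
  \<comment> \<open>p^d becomes the exponent of \<open>G\<close> modulo \<open>K\<close>. As
    \<open>K\<close> is proper, d > 0, and so x^p = 1 gives x^(p^d) = 1.\<close>
  define P where "P d \<longleftrightarrow> (\<forall>g\<in>carrier G. g [^] (p ^ d) \<in> K)" for d
  define d where "d = (LEAST d. P d)"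
  obtain n where "P n" using p_group_exponent subgroup.one_closed[OF K] unfolding P_def by metis
  then have Pd: "P d" unfolding d_def by (rule LeastI)
  have min: "\<exists>g\<in>carrier G. g [^] (p ^ c) \<notin> K" if "c < d" for c
    using not_less_Least[of c P] that unfolding d_def P_def by blast
  have "d \<noteq> 0"
  proof
    assume "d = 0"
    then have "carrier G \<subseteq> K" using Pd by (auto simp: P_def)
    then show False using \<open>K \<noteq> carrier G\<close> subgroup.subset[OF K] by blast
  qed
  then obtain c where c: "d = Suc c" using not0_implies_Suc by blast
  then have "x [^] (p ^ d) = (x [^] p) [^] (p ^ c)" using xG by (simp add: nat_pow_pow)
  then have xd: "x [^] (p ^ d) = \<one>" using x(3) by simp
  have all: "g [^] (p ^ d) \<in> K" if "g \<in> carrier G" for g using Pd that by (simp add: P_def)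
  obtain a \<phi> where a: "a \<in> carrier G"
    and \<phi>: "\<phi> \<in> carrier (End_monoid G)" "\<phi> a = x" "\<And>k. k \<in> K \<Longrightarrow> \<phi> k = \<one>"
      "\<And>g. g \<in> carrier G \<Longrightarrow> \<exists>i::int. \<phi> g = x [^] i"
    using exists_End_mapping_to[OF p_group_finite p K DK[unfolded D_def] all min] xG xd by metis
  have \<phi>H: "\<phi> g \<in> H" if "g \<in> carrier G" for g
    using \<phi>(4)[OF that] subgroup_int_pow_closed[OF H x(1)] by metis
  have \<phi>_comm: "\<phi> g \<otimes> y = y \<otimes> \<phi> g" if g: "g \<in> carrier G" and y: "y \<in> carrier G" for g y
  proof -
    have "x \<in> center G" using xG x_comm by (simp add: center_def)
    then have "\<phi> g \<in> center G"
      using \<phi>(4)[OF g] subgroup_int_pow_closed[OF center_subgroup] by metis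
    then show ?thesis using y by (simp add: center_def)
  qed
  \<comment> \<open>\<alpha> is multiplicative because the values of \<phi>, being powers of the
    central element \<open>x\<close>, are central.\<close>
  define \<alpha> where "\<alpha> = (\<lambda>g\<in>carrier G. g \<otimes> \<phi> g)"
  have \<alpha>: "\<alpha> \<in> carrier (End_monoid G)"
  proof -
    have "g \<otimes> h \<otimes> \<phi> (g \<otimes> h) = g \<otimes> \<phi> g \<otimes> (h \<otimes> \<phi> h)" if gh: "g \<in> carrier G" "h \<in> carrier G" for g h
    proof -
      have \<phi>gh: "\<phi> g \<in> carrier G" "\<phi> h \<in> carrier G" using gh End_apply(1)[OF \<phi>(1)] by auto
      have "g \<otimes> h \<otimes> \<phi> (g \<otimes> h) = g \<otimes> (h \<otimes> \<phi> g) \<otimes> \<phi> h"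
        using gh \<phi>gh End_apply(2)[OF \<phi>(1) gh] by (simp add: m_assoc)
      also have "h \<otimes> \<phi> g = \<phi> g \<otimes> h" using \<phi>_comm[OF gh] by simp
      finally show ?thesis using gh \<phi>gh by (simp add: m_assoc)
    qed
    then show ?thesis
      using End_apply(1)[OF \<phi>(1)] by (auto simp: \<alpha>_def End_monoid_iff hom_def)
  qed
  \<comment> \<open>If g \<phi>(g) = 1, then g is the inverse of a power of \<open>x\<close> and
    lies in H \<subseteq> K. There \<phi> vanishes, so g = 1.\<close>
  have "\<alpha> \<in> auto G"
  proof (rule finite_inj_End_auto[OF p_group_finite \<alpha> End_inj_onI[OF \<alpha>]])
    fix g assume g: "g \<in> carrier G" and "\<alpha> g = \<one>"
    then have 1: "g \<otimes> \<phi> g = \<one>" by (simp add: \<alpha>_def)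
    then have "g = inv (\<phi> g)" using g End_apply(1)[OF \<phi>(1) g] by (metis inv_equality)
    then have "g \<in> H" using \<phi>H[OF g] H.m_inv_closed by metis
    then have "\<phi> g = \<one>" using HK \<phi>(3) by blast
    then show "g = \<one>" using 1 g by simp
  qed
  \<comment> \<open>On one side \<phi> kills \<pi>(a), which lies in \<open>H\<close>, and the
    result is \<pi>(a). On the other side \<alpha>(a) = a x and \<pi> fixes \<open>x\<close>, so the
    result is \<pi>(a) x.\<close>
  then have "\<alpha> (\<pi> a) = \<pi> (\<alpha> a)" using commute_apply[OF subsetD[OF aut] \<pi> a] by simp
  moreover have \<pi>a: "\<pi> a \<in> H" using a by (simp add: H_def)
  then have "\<alpha> (\<pi> a) = \<pi> a" using \<phi>(3)[OF subsetD[OF HK \<pi>a]] by (simp add: \<alpha>_def)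
  moreover have "\<pi> (\<alpha> a) = \<pi> a \<otimes> x"
    using a xG \<phi>(2) \<pi>H[OF x(1)] by (simp add: \<alpha>_def End_apply[OF \<pi>])
  ultimately have "\<pi> a \<otimes> x = \<pi> a" by simp
  then show False using x(2) xG H.mem_carrier[OF \<pi>a] by simp
qed

end

section \<open>Semidirect projections and powers of endomorphisms\<close>

context group
begin

text \<open>The map n h \<mapsto> h is well defined because N \<inter> H = 1. It is multiplicative
  because (n h)(m l) = n (h m h^(-1)) (h l), where the middle factor lies in the normal subgroup
  \<open>N\<close>.\<close>

lemma semidirect_projection:
  assumes "semidirect_decomp G N H"
  obtains \<pi> where "\<pi> \<in> carrier (End_monoid G)" "\<pi> ` carrier G = H"
    "\<And>h. h \<in> H \<Longrightarrow> \<pi> h = h" "\<And>n. n \<in> N \<Longrightarrow> \<pi> n = \<one>"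
proof -
  have NG: "N \<lhd> G" and HG: "subgroup H G" and NH: "N <#> H = carrier G" and int: "N \<inter> H = {\<one>}"
    using assms by (auto simp: semidirect_decomp_def)
  interpret N: normal N G by (rule NG)
  interpret H: subgroup H G by (rule HG)
  have ex: "\<exists>h. h \<in> H \<and> (\<exists>n\<in>N. g = n \<otimes> h)" if "g \<in> carrier G" for g
    using that unfolding NH[symmetric] set_mult_iff by metis
  have uniq: "h = k" if h: "h \<in> H" and k: "k \<in> H" and n: "n \<in> N" and m: "m \<in> N"
    and eq: "n \<otimes> h = m \<otimes> k" for h k n m
  proof -
    have G: "h \<in> carrier G" "k \<in> carrier G" "n \<in> carrier G" "m \<in> carrier G"
      using h k n m by auto
    have "inv m \<otimes> (n \<otimes> h) = k" using eq G by (simp add: inv_mult_cancel)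
    then have "inv m \<otimes> n = k \<otimes> inv h" using G by (simp add: m_assoc inv_solve_right)
    moreover have "inv m \<otimes> n \<in> N" "k \<otimes> inv h \<in> H" using h k n m by simp_all
    ultimately have "k \<otimes> inv h = \<one>" using int by auto
    then have "k \<otimes> inv h \<otimes> h = h" using G by simp
    then show ?thesis using G by (simp add: m_assoc)
  qed
  define \<pi> where "\<pi> = (\<lambda>g\<in>carrier G. THE h. h \<in> H \<and> (\<exists>n\<in>N. g = n \<otimes> h))"
  have \<pi>: "\<pi> (n \<otimes> h) = h" if n: "n \<in> N" and h: "h \<in> H" for n h
  proof -
    have "(THE k. k \<in> H \<and> (\<exists>m\<in>N. n \<otimes> h = m \<otimes> k)) = h"
      using n h uniq by (intro the_equality) metis+
    then show ?thesis using n h by (simp add: \<pi>_def)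
  qed
  have \<pi>H: "\<pi> g \<in> H" if "g \<in> carrier G" for g using ex[OF that] \<pi> by metis
  have mult: "\<pi> (g \<otimes> k) = \<pi> g \<otimes> \<pi> k" if gk: "g \<in> carrier G" "k \<in> carrier G" for g k
  proof -
    obtain n h where 1: "h \<in> H" "n \<in> N" "g = n \<otimes> h" using ex[OF gk(1)] by metis
    obtain m l where 2: "l \<in> H" "m \<in> N" "k = m \<otimes> l" using ex[OF gk(2)] by metis
    have G: "h \<in> carrier G" "l \<in> carrier G" "n \<in> carrier G" "m \<in> carrier G"
      using 1 2 by auto
    have "g \<otimes> k = (n \<otimes> (h \<otimes> m \<otimes> inv h)) \<otimes> (h \<otimes> l)"
      unfolding 1(3) 2(3) using G by (simp add: m_assoc inv_mult_cancel)
    moreover have "n \<otimes> (h \<otimes> m \<otimes> inv h) \<in> N" using 1(2) N.inv_op_closed2[OF G(1) 2(2)] by simp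
    ultimately show ?thesis using \<pi> 1 2 by (metis H.m_closed)
  qed
  show thesis
  proof (rule that)
    show "\<pi> \<in> carrier (End_monoid G)"
      using \<pi>H mult by (auto simp: End_monoid_iff hom_def \<pi>_def)
    show \<pi>h: "\<pi> h = h" if "h \<in> H" for h using \<pi>[OF N.one_closed that] that by simp
    show "\<pi> ` carrier G = H"
    proof
      show "\<pi> ` carrier G \<subseteq> H" using \<pi>H by blast
      show "H \<subseteq> \<pi> ` carrier G" using \<pi>h H.mem_carrier by (metis image_iff subsetI)
    qed
    show "\<pi> n = \<one>" if "n \<in> N" for n using \<pi>[OF that H.one_closed] that by simp
  qed
qed

text \<open>The power of \<phi> with exponent n - 1 is a left inverse of \<phi> on the carrier, and
  an injective endomorphism of a finite group is an automorphism.\<close>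

lemma auto_of_pow_id:
  assumes fin: "finite (carrier G)" and \<phi>: "\<phi> \<in> carrier (End_monoid G)" and n: "0 < (n::nat)"
    and id: "\<And>g. g \<in> carrier G \<Longrightarrow> (\<phi> [^]\<^bsub>End_monoid G\<^esub> n) g = g"
  shows "\<phi> \<in> auto G"
proof -
  obtain m where m: "n = Suc m" using n gr0_implies_Suc by blast
  have "(\<phi> [^]\<^bsub>End_monoid G\<^esub> m) (\<phi> g) = g" if "g \<in> carrier G" for g
    using id[OF that] End_mult_apply[OF that] by (simp add: m)
  then have "inj_on \<phi> (carrier G)" by (rule inj_on_inverseI)
  then show ?thesis by (rule finite_inj_End_auto[OF fin \<phi>])
qed

end

section \<open>The three assertions\<close>

theorem mainTheorem3:
  fixes G :: "('a, 'b) monoid_scheme" and p e :: nat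
  assumes "prime p"
    and "finite_p_group p G"
    and "real e = log (real p) (real (group_exponent (G Mod derived G (carrier G))))"
  shows "(auto G \<subseteq> center (End_monoid G) \<longrightarrow>
            (\<forall>\<phi>\<in>carrier (End_monoid G). characteristic (\<phi> ` carrier G) G) \<and>
            (\<forall>C. cyclic_subgroup C G \<and> card C dvd p ^ e \<longrightarrow> characteristic C G) \<and>
            Omega1 p G \<subseteq> center G) \<and>
         (comm_monoid (End_monoid G) \<longrightarrow>
            (\<forall>\<phi>\<in>carrier (End_monoid G). fully_invariant (\<phi> ` carrier G) G) \<and>
            (\<forall>C. cyclic_subgroup C G \<and> card C dvd p ^ e \<longrightarrow> fully_invariant C G)) \<and>
         (auto G \<subseteq> center (End_monoid G) \<longrightarrow>
            \<not> (\<exists>N H. N \<noteq> {\<one>\<^bsub>G\<^esub>} \<and> H \<noteq> {\<one>\<^bsub>G\<^esub>} \<and> semidirect_decomp G N H) \<and>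
            (\<forall>\<phi>\<in>carrier (End_monoid G).
               \<phi> \<in> auto G \<or>
               (\<exists>n::nat. 0 < n \<and> \<phi> [^]\<^bsub>End_monoid G\<^esub> n = trivial_endo G)))"
proof -
  interpret group G using assms(2) by (simp add: finite_p_group_def)
  have fin: "finite (carrier G)" using assms(2) by (rule p_group_finite[OF assms(1)])
  note cyclic = cyclic_is_End_image[OF assms]
  note no_idem = no_proper_idempotent_endo[OF assms]
  \<comment> \<open>The projection onto \<open>H\<close> along \<open>N\<close> is idempotent with
    nontrivial image, so it must be the identity. It also kills \<open>N\<close>, which is then
    trivial.\<close>
  have no_semidirect: False
    if aut: "auto G \<subseteq> center (End_monoid G)" and N: "N \<noteq> {\<one>\<^bsub>G\<^esub>}" and H: "H \<noteq> {\<one>\<^bsub>G\<^esub>}"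
      and NH: "semidirect_decomp G N H" for N H
  proof -
    obtain \<pi> where \<pi>: "\<pi> \<in> carrier (End_monoid G)" "\<pi> ` carrier G = H"
      "\<And>h. h \<in> H \<Longrightarrow> \<pi> h = h" "\<And>n. n \<in> N \<Longrightarrow> \<pi> n = \<one>\<^bsub>G\<^esub>"
      using semidirect_projection[OF NH] by metis
    have "\<pi> (\<pi> g) = \<pi> g" if "g \<in> carrier G" for g using \<pi>(2,3) that by blast
    then have id: "\<forall>g\<in>carrier G. \<pi> g = g" using no_idem[OF aut \<pi>(1)] \<pi>(2) H by blast
    have "subgroup N G" using NH by (simp add: semidirect_decomp_def normal_imp_subgroup)
    then have "N \<subseteq> carrier G" "\<one>\<^bsub>G\<^esub> \<in> N" by (rule subgroup.subset, rule subgroup.one_closed)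
    then have "N = {\<one>\<^bsub>G\<^esub>}" using id \<pi>(4) by force
    then show False using N by blast
  qed
  have auto_or_nilpotent: "\<phi> \<in> auto G \<or> (\<exists>n::nat. 0 < n \<and> \<phi> [^]\<^bsub>End_monoid G\<^esub> n = trivial_endo G)"
    if aut: "auto G \<subseteq> center (End_monoid G)" and \<phi>: "\<phi> \<in> carrier (End_monoid G)" for \<phi>
  proof -
    interpret E: monoid "End_monoid G" by (rule monoid_End)
    obtain n :: nat where n: "0 < n"
      "\<phi> [^]\<^bsub>End_monoid G\<^esub> n \<otimes>\<^bsub>End_monoid G\<^esub> \<phi> [^]\<^bsub>End_monoid G\<^esub> n = \<phi> [^]\<^bsub>End_monoid G\<^esub> n"
      using E.exists_idempotent_power[OF finite_End[OF fin] \<phi>] by metis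
    define \<epsilon> where "\<epsilon> = \<phi> [^]\<^bsub>End_monoid G\<^esub> n"
    have \<epsilon>: "\<epsilon> \<in> carrier (End_monoid G)" unfolding \<epsilon>_def using \<phi> by (rule E.nat_pow_closed)
    have "\<epsilon> (\<epsilon> g) = \<epsilon> g" if "g \<in> carrier G" for g
      using End_mult_apply[OF that, of \<epsilon> \<epsilon>] n(2) by (simp add: \<epsilon>_def)
    \<comment> \<open>An idempotent power of \<phi> is either trivial, making \<phi> nilpotent, or
      the identity, making \<phi> an automorphism.\<close>
    then consider "\<epsilon> ` carrier G = {\<one>\<^bsub>G\<^esub>}" | "\<forall>g\<in>carrier G. \<epsilon> g = g"
      using no_idem[OF aut \<epsilon>] by blast
    then show ?thesis
    proof cases
      case 1
      have "\<epsilon> = trivial_endo G"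
      proof (rule extensionalityI)
        show "\<epsilon> \<in> extensional (carrier G)" using \<epsilon> by (simp add: End_monoid_iff)
        show "trivial_endo G \<in> extensional (carrier G)" by (simp add: trivial_endo_def)
        show "\<epsilon> g = trivial_endo G g" if "g \<in> carrier G" for g
          using 1 that by (auto simp: trivial_endo_def)
      qed
      then have "\<phi> [^]\<^bsub>End_monoid G\<^esub> n = trivial_endo G" unfolding \<epsilon>_def .
      then show ?thesis using n(1) by metis
    next
      case 2
      then have "\<phi> \<in> auto G" unfolding \<epsilon>_def by (intro auto_of_pow_id[OF fin \<phi> n(1)]) (rule bspec)
      then show ?thesis ..
    qed
  qed
  have char_cyclic: "characteristic C G"
    if "auto G \<subseteq> center (End_monoid G)" "cyclic_subgroup C G \<and> card C dvd p ^ e" for C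
    using cyclic[of C] that(2) image_characteristic[OF that(1)] by auto
  have inv_cyclic: "fully_invariant C G"
    if "comm_monoid (End_monoid G)" "cyclic_subgroup C G \<and> card C dvd p ^ e" for C
    using cyclic[of C] that(2) image_fully_invariant[OF that(1)] by auto
  show ?thesis
  proof (intro conjI impI ballI allI notI)
    assume aut: "auto G \<subseteq> center (End_monoid G)"
    show "characteristic (\<phi> ` carrier G) G" if "\<phi> \<in> carrier (End_monoid G)" for \<phi>
      using aut that by (rule image_characteristic)
    show "characteristic C G" if "cyclic_subgroup C G \<and> card C dvd p ^ e" for C
      using aut that by (rule char_cyclic)
    show "Omega1 p G \<subseteq> center G" using assms aut by (rule Omega1_central)
    show False if "\<exists>N H. N \<noteq> {\<one>\<^bsub>G\<^esub>} \<and> H \<noteq> {\<one>\<^bsub>G\<^esub>} \<and> semidirect_decomp G N H"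
      using that no_semidirect[OF aut] by metis
    show "\<phi> \<in> auto G \<or> (\<exists>n::nat. 0 < n \<and> \<phi> [^]\<^bsub>End_monoid G\<^esub> n = trivial_endo G)"
      if "\<phi> \<in> carrier (End_monoid G)" for \<phi>
      using aut that by (rule auto_or_nilpotent)
  next
    assume comm: "comm_monoid (End_monoid G)"
    show "fully_invariant (\<phi> ` carrier G) G" if "\<phi> \<in> carrier (End_monoid G)" for \<phi>
      using comm that by (rule image_fully_invariant)
    show "fully_invariant C G" if "cyclic_subgroup C G \<and> card C dvd p ^ e" for C
      using comm that by (rule inv_cyclic)
  qed
qed

end
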